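(* Let $(A,\mathbf{C})$ be a closure algebra in which $A$ is a complete Boolean algebra. Define, for each finite non-empty $\varGamma\subseteq A$, $$\mathbf{C}^t\varGamma=\bigvee\Big\{a\in A:\ a\leq \textstyle\bigwedge_{\gamma\in\varGamma}\mathbf{C}(\gamma\land a)\Big\}.$$ Then $(A,\mathbf{C}^t)$ is a tangled closure algebra whose induced closure operator is $\mathbf{C}$ (i.e. $\mathbf{C}^t\{a\}=\mathbf{C}a$ for all $a$), and it is the unique tangled closure operator on $A$ inducing $\mathbf{C}$.
   Context: Let $A$ be a Boolean algebra with operations $\land,\lor,-,0,1$; write $a\Rightarrow b=-a\lor b$. A closure operator on $A$ is a map $\mathbf{C}:A\to A$ with $\mathbf{C}(a\lor b)=\mathbf{C}a\lor\mathbf{C}b$, $\mathbf{C}0=0$, $a\leq\mathbf{C}a=\mathbf{C}\mathbf{C}a$; $(A,\mathbf{C})$ is then a closure algebra, and $\mathbf{I}a=-\mathbf{C}-a$ is its interior operator. Let $\mathcal{P}_{fin}A$ be the set of finite non-empty subsets of $A$. Given $\mathbf{C}^t:\mathcal{P}_{fin}A\to A$, the induced unary map is $a\mapsto\mathbf{C}^t\{a\}$ with dual $a\mapsto-\mathbf{C}^t\{-a\}$. $(A,\mathbf{C}^t)$ is a tangled closure algebra if the induced unary map (call it $\mathbf{C}$, dual $\mathbf{I}$) is a closure operator and for all $\varGamma\in\mathcal{P}_{fin}A$ and $a\in A$: (Fix) $\mathbf{C}^t\varGamma\leq\bigwedge_{\gamma\in\varGamma}\mathbf{C}(\gamma\land\mathbf{C}^t\varGamma)$;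 (Ind) $\mathbf{I}\big(a\Rightarrow\bigwedge_{\gamma\in\varGamma}\mathbf{C}(\gamma\land a)\big)\land a\leq\mathbf{C}^t\varGamma$. *)

theory Defs
  imports Main
begin

unbundle lattice_syntax

text \<open>
  A complete Boolean algebra is rendered by the sort \<open>{boolean_algebra, complete_lattice}\<close>. The
  library class \<open>complete_boolean_algebra\<close> is not suitable: it also demands complete
  distributivity.
\<close>

definition closure_operator :: "('a::boolean_algebra \<Rightarrow> 'a) \<Rightarrow> bool" where
  "closure_operator C \<longleftrightarrow>
     (\<forall>a b. C (a \<squnion> b) = C a \<squnion> C b) \<and> C \<bottom> = \<bottom> \<and> (\<forall>a. a \<le> C a) \<and> (\<forall>a. C a = C (C a))"

definition interior_of :: "('a::boolean_algebra \<Rightarrow> 'a) \<Rightarrow> 'a \<Rightarrow> 'a" where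
  "interior_of C a = - C (- a)"

definition bimp :: "'a::boolean_algebra \<Rightarrow> 'a \<Rightarrow> 'a" where
  "bimp a b = - a \<squnion> b"

definition pfin :: "'a set set" where
  "pfin = {G. finite G \<and> G \<noteq> {}}"

definition induced_op :: "('a set \<Rightarrow> 'a) \<Rightarrow> 'a \<Rightarrow> 'a" where
  "induced_op Ct a = Ct {a}"

definition tangle_step :: "('a::boolean_algebra \<Rightarrow> 'a) \<Rightarrow> 'a set \<Rightarrow> 'a \<Rightarrow> 'a" where
  "tangle_step C G a = \<Sqinter>\<^sub>f\<^sub>i\<^sub>n ((\<lambda>g. C (g \<sqinter> a)) ` G)"

text \<open>
  A map on the finite non-empty subsets is represented by a total function on all subsets;
  its values outside \<open>pfin\<close> are irrelevant.
\<close>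

definition tangled_closure_operator :: "('a::boolean_algebra set \<Rightarrow> 'a) \<Rightarrow> bool" where
  "tangled_closure_operator Ct \<longleftrightarrow>
     closure_operator (induced_op Ct) \<and>
     (\<forall>G\<in>pfin. Ct G \<le> tangle_step (induced_op Ct) G (Ct G)) \<and>
     (\<forall>G\<in>pfin. \<forall>a.
        interior_of (induced_op Ct) (bimp a (tangle_step (induced_op Ct) G a)) \<sqinter> a \<le> Ct G)"

definition tangle :: "('a::{boolean_algebra, complete_lattice} \<Rightarrow> 'a) \<Rightarrow> 'a set \<Rightarrow> 'a" where
  "tangle C G = \<Squnion> {a. a \<le> tangle_step C G a}"

end

theory Submission
  imports Defs
begin

text \<open>
  The map \<open>tangle_step C G\<close> is monotone, so by Knaster--Tarski \<open>tangle C G\<close> is its greatest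
  post-fixed point, which is (Fix). For (Ind), an open element \<open>i\<close> satisfies
  \<open>i \<sqinter> C x \<le> C (i \<sqinter> x)\<close>, whence the left-hand side of (Ind) is itself a post-fixed point.
  Conversely, (Fix) says that \<open>Ct G\<close> is a post-fixed point, and (Ind) that it lies above
  every post-fixed point, because the interior of the top element is the top element.
\<close>

lemma closure_operator_mono:
  assumes "closure_operator C" "a \<le> b"
  shows "C a \<le> C b"
  using assms unfolding closure_operator_def by (metis sup.absorb_iff2)

lemma interior_of_top:
  assumes "closure_operator C"
  shows "interior_of C \<top> = \<top>"
  using assms unfolding closure_operator_def interior_of_def
  by (metis compl_top_eq compl_bot_eq)

lemma interior_of_le:
  assumes "closure_operator C"
  shows "interior_of C a \<le> a"
  using assms unfolding closure_operator_def interior_of_def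
  by (metis compl_le_swap2)

text \<open>Split \<open>x\<close> along the open element and its complement. The complement is
  closed, so by additivity \<open>C x\<close> exceeds the closure of the part inside by at most that
  complement, which the meet with the open element removes.\<close>

lemma interior_inf_closure_le:
  assumes C: "closure_operator C"
  shows "interior_of C a \<sqinter> C x \<le> C (interior_of C a \<sqinter> x)"
proof -
  let ?i = "interior_of C a"
  have closed: "C (- ?i) = - ?i"
    using C unfolding closure_operator_def interior_of_def by (metis double_compl)
  have "x \<le> (?i \<sqinter> x) \<squnion> - ?i"
    by (simp add: sup_inf_distrib2)
  then have "C x \<le> C ((?i \<sqinter> x) \<squnion> - ?i)"
    by (rule closure_operator_mono[OF C])
  also have "\<dots> = C (?i \<sqinter> x) \<squnion> - ?i"
    using C closed unfolding closure_operator_def by metis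
  finally have "?i \<sqinter> C x \<le> ?i \<sqinter> (C (?i \<sqinter> x) \<squnion> - ?i)"
    by (rule inf_mono[OF order_refl])
  also have "\<dots> \<le> C (?i \<sqinter> x)"
    by (simp add: inf_sup_distrib1)
  finally show ?thesis .
qed

lemma inf_bimp_le: "bimp a b \<sqinter> a \<le> b"
  by (simp add: bimp_def inf_sup_distrib2)

lemma bimp_eq_top: "a \<le> b \<Longrightarrow> bimp a b = \<top>"
  unfolding bimp_def by (metis compl_sup_top sup_mono order_refl top_unique)

text \<open>Reduces bounds on the finite meet to one \<open>g\<close> at a time; \<open>pfin\<close>
  supplies the finiteness and non-emptiness that \<open>Inf_fin\<close> relies on.\<close>

lemma le_tangle_step_iff:
  assumes "G \<in> pfin"
  shows "b \<le> tangle_step C G a \<longleftrightarrow> (\<forall>g\<in>G. b \<le> C (g \<sqinter> a))"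
  using assms unfolding tangle_step_def pfin_def by (simp add: Inf_fin.bounded_iff)

lemma tangle_step_mono:
  assumes "closure_operator C" "G \<in> pfin" "a \<le> b"
  shows "tangle_step C G a \<le> tangle_step C G b"
proof -
  have "\<forall>g\<in>G. tangle_step C G a \<le> C (g \<sqinter> a)"
    using le_tangle_step_iff[OF assms(2)] by blast
  moreover have "C (g \<sqinter> a) \<le> C (g \<sqinter> b)" for g
    by (rule closure_operator_mono[OF assms(1) inf_mono[OF order_refl assms(3)]])
  ultimately show ?thesis
    unfolding le_tangle_step_iff[OF assms(2)] by (meson order_trans)
qed

lemma tangle_upper: "a \<le> tangle_step C G a \<Longrightarrow> a \<le> tangle C G"
  unfolding tangle_def by (simp add: Sup_upper)

lemma tangle_least: "(\<And>a. a \<le> tangle_step C G a \<Longrightarrow> a \<le> b) \<Longrightarrow> tangle C G \<le> b"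
  unfolding tangle_def by (rule Sup_least) simp

text \<open>By monotonicity, the step applied to the supremum bounds every post-fixed point, hence
  also the supremum itself.\<close>

lemma tangle_le_tangle_step:
  assumes "closure_operator C" "G \<in> pfin"
  shows "tangle C G \<le> tangle_step C G (tangle C G)"
proof (rule tangle_least)
  fix a assume a: "a \<le> tangle_step C G a"
  also have "\<dots> \<le> tangle_step C G (tangle C G)"
    using assms tangle_upper[OF a] by (rule tangle_step_mono)
  finally show "a \<le> tangle_step C G (tangle C G)" .
qed

lemma tangle_singleton:
  assumes C: "closure_operator C"
  shows "tangle C {a} = C a"
proof (rule antisym)
  have step: "tangle_step C {a} x = C (a \<sqinter> x)" for x
    by (simp add: tangle_step_def)
  show "tangle C {a} \<le> C a"
  proof (rule tangle_least)
    fix x assume "x \<le> tangle_step C {a} x"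
    also have "\<dots> \<le> C a"
      unfolding step by (rule closure_operator_mono[OF C inf.cobounded1])
    finally show "x \<le> C a" .
  qed
  \<comment> \<open>This makes \<open>C a\<close> a post-fixed point for \<open>{a}\<close>, as the
    step sends it to \<open>C (a \<sqinter> C a) = C a\<close>.\<close>
  have "a \<sqinter> C a = a"
    using C unfolding closure_operator_def by (metis inf.absorb1)
  then show "C a \<le> tangle C {a}"
    by (intro tangle_upper) (simp add: step)
qed

lemma tangle_induction:
  assumes C: "closure_operator C" and G: "G \<in> pfin"
  shows "interior_of C (bimp a (tangle_step C G a)) \<sqinter> a \<le> tangle C G"
proof (rule tangle_upper)
  let ?i = "interior_of C (bimp a (tangle_step C G a))"
  have "?i \<sqinter> a \<le> tangle_step C G a"
    by (rule order_trans[OF inf_mono[OF interior_of_le[OF C] order_refl] inf_bimp_le])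
  then have *: "\<forall>g\<in>G. ?i \<sqinter> a \<le> C (g \<sqinter> a)"
    using le_tangle_step_iff[OF G] by blast
  show "?i \<sqinter> a \<le> tangle_step C G (?i \<sqinter> a)"
    unfolding le_tangle_step_iff[OF G]
  proof
    fix g assume "g \<in> G"
    \<comment> \<open>The factor \<open>?i\<close> is kept on the right so that, being open, it can
      next be moved inside \<open>C\<close>.\<close>
    with * have "?i \<sqinter> a \<le> ?i \<sqinter> C (g \<sqinter> a)"
      by simp
    also have "\<dots> \<le> C (?i \<sqinter> (g \<sqinter> a))"
      by (rule interior_inf_closure_le[OF C])
    finally show "?i \<sqinter> a \<le> C (g \<sqinter> (?i \<sqinter> a))"
      by (simp add: inf_left_commute)
  qed
qed

lemma tangled_closure_operator_tangle:
  assumes "closure_operator C"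
  shows "tangled_closure_operator (tangle C)"
proof -
  have "induced_op (tangle C) = C"
    using tangle_singleton[OF assms] by (auto simp: induced_op_def)
  then show ?thesis
    unfolding tangled_closure_operator_def
    using assms tangle_le_tangle_step[OF assms] tangle_induction[OF assms] by metis
qed

lemma tangled_closure_operator_unique:
  assumes Ct: "tangled_closure_operator Ct" and G: "G \<in> pfin"
  shows "Ct G = tangle (induced_op Ct) G"
proof (rule antisym)
  let ?C = "induced_op Ct"
  show "Ct G \<le> tangle ?C G"
    using Ct G unfolding tangled_closure_operator_def by (intro tangle_upper) blast
  show "tangle ?C G \<le> Ct G"
  proof (rule tangle_least)
    fix a assume "a \<le> tangle_step ?C G a"
    moreover have "interior_of ?C (bimp a (tangle_step ?C G a)) \<sqinter> a \<le> Ct G"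
      using Ct G unfolding tangled_closure_operator_def by blast
    moreover have "closure_operator ?C"
      using Ct unfolding tangled_closure_operator_def by blast
    \<comment> \<open>For a post-fixed point \<open>a\<close> the implication is
      \<open>\<top>\<close>, and so is its interior; (Ind) collapses to the goal.\<close>
    ultimately show "a \<le> Ct G"
      by (simp add: bimp_eq_top interior_of_top)
  qed
qed

theorem theorem2p3:
  fixes C :: "'a::{boolean_algebra, complete_lattice} \<Rightarrow> 'a"
  assumes "closure_operator C"
  shows "tangled_closure_operator (tangle C) \<and>
         (\<forall>a. tangle C {a} = C a) \<and>
         (\<forall>Ct :: 'a set \<Rightarrow> 'a.
            tangled_closure_operator Ct \<and> (\<forall>a. Ct {a} = C a) \<longrightarrow>
            (\<forall>G\<in>pfin. Ct G = tangle C G))"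
proof (intro conjI allI impI ballI)
  show "tangled_closure_operator (tangle C)"
    using assms by (rule tangled_closure_operator_tangle)
  show "tangle C {a} = C a" for a
    using assms by (rule tangle_singleton)
  fix Ct :: "'a set \<Rightarrow> 'a" and G :: "'a set"
  assume Ct: "tangled_closure_operator Ct \<and> (\<forall>a. Ct {a} = C a)" and "G \<in> pfin"
  \<comment> \<open>Agreement on singletons is equality of functions, so the tangle built from
    \<open>induced_op Ct\<close> is the one built from \<open>C\<close>.\<close>
  then have "induced_op Ct = C"
    by (auto simp: induced_op_def)
  with Ct \<open>G \<in> pfin\<close> show "Ct G = tangle C G"
    using tangled_closure_operator_unique by metis
qed

end
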